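(* Define recursively $IpP_1=\{2\}$, $pP_1=\{2\}$, and for $i=1,2,\ldots$ $$IpP_{i+1}=[MIpP_i+1,\;2MpP_i],\qquad pP_{i+1}=\varphi(IpP_{i+1}),$$ where $MIpP_i=\max IpP_i$ and $MpP_i=\max pP_i$ (so that $IpP_2=[3,4]$, $pP_2=\{3\}$, $IpP_3=[5,6]$, $pP_3=\{5\}$, $IpP_4=[7,10]$, $pP_4=\{7\}$, $IpP_5=[11,14]$, $pP_5=\{11,13\}$, $\ldots$). Then: (a) the set $\mathbb{P}$ of all prime numbers satisfies $\mathbb{P}=\varphi(\mathbb{N})=\bigcup_{j=1}^{\infty}pP_j$; (b) the family $\{pP_1,pP_2,\ldots,pP_i,\ldots\}$ is a partition of the set of all primes.
   Context: $\mathbb{N}=\{1,2,\ldots\}$. For $m\le n$ in $\mathbb{N}$, $[m,n]=\{k\in\mathbb{N}: m\le k\le n\}$. For $S\subseteq\mathbb{N}$, $\varphi(S)$ is the set of all primes in $S$. A partition of a set is a family of non-empty, pairwise disjoint subsets whose union is the set. *)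

theory Defs
  imports "HOL-Computational_Algebra.Primes" "HOL-Library.Disjoint_Sets"
begin

definition primes_in :: "nat set \<Rightarrow> nat set" where
  "primes_in S = {p \<in> S. prime p}"

text \<open>
  The sequences are indexed from 1; index 0 is a dummy. The recursion is meaningful only
  because the sets are finite and nonempty, so that \<^const>\<open>Max\<close> is a genuine maximum:
  finiteness is clear, while nonemptiness of \<open>pP i\<close> for \<open>i \<ge> 1\<close>
  (hence of \<open>IpP i\<close>) is not a consequence of the definition alone.
\<close>

function IpP :: "nat \<Rightarrow> nat set" and pP :: "nat \<Rightarrow> nat set" where
  "IpP 0 = {}"
| "IpP (Suc 0) = {2}"
| "IpP (Suc (Suc i)) = {Max (IpP (Suc i)) + 1 .. 2 * Max (pP (Suc i))}"
| "pP 0 = {}"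
| "pP (Suc 0) = {2}"
| "pP (Suc (Suc i)) = primes_in (IpP (Suc (Suc i)))"
  by pat_completeness auto
termination
  by (relation "measure (case_sum (\<lambda>i. 2 * i) (\<lambda>i. 2 * i + 1))") auto

end

(*
  Put M_0 = 1 and let M_i be the maximum of IpP_i for i >= 1. Then IpP_i is the integer interval
  (M_(i-1), M_i], so the theorem follows once these intervals are nonempty and each contains a
  prime. Let q = max pP_i. Inductively, q is the largest prime up to M_i and M_i < 2 q; hence
  Bertrand's postulate gives a prime in (q, 2 q], which must exceed M_i, while M_(i+1) = 2 q.
  Thus pP_(i+1) is nonempty, and its maximum exceeds q, so M_(i+1) is less than twice that maximum.

  Bertrand's postulate is proved by Erdos' argument: without primes in (n, 2 n], the primes
  dividing binomial(2 n, n) are at most 2 n / 3; their prime powers are at most 2 n, and those of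
  primes above sqrt(2 n) have exponent one. As the product of the primes up to m is at most 4^m,
  this contradicts binomial(2 n, n) >= 4^n / (2 n) when n >= 450.
*)
theory Submission
  imports Defs "HOL-Library.Discrete_Functions"
begin

section \<open>Prime powers in factorials and central binomial coefficients\<close>

lemma div_Suc_eq: "Suc n div q = n div q + (if q dvd Suc n then 1 else 0)"
proof -
  have "q dvd Suc n \<longleftrightarrow> Suc n mod q = 0" by (rule dvd_eq_mod_eq_0)
  thus ?thesis by (simp only: div_Suc split: if_splits) simp
qed

lemma multiplicity_eq_card:
  fixes p m K :: nat
  assumes p: "prime p" and m: "m > 0" "m < p ^ Suc K"
  shows "multiplicity p m = card {k \<in> {1..K}. p ^ k dvd m}"
proof -
  have unit: "\<not> is_unit p"
    using p by auto
  have le: "multiplicity p m \<le> K"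
  proof (rule ccontr)
    assume "\<not> multiplicity p m \<le> K"
    hence "p ^ Suc K dvd m"
      by (intro multiplicity_dvd') auto
    thus False
      using m by (auto dest: dvd_imp_le)
  qed
  have "{k \<in> {1..K}. p ^ k dvd m} = {1..multiplicity p m}"
    using le m unit by (auto simp: power_dvd_iff_le_multiplicity)
  thus ?thesis by simp
qed

text \<open>Legendre's formula, cut off at \<open>K\<close>: passing from \<open>n\<close> to
  \<open>Suc n\<close> raises \<open>n div p ^ k\<close> by one exactly when \<open>p ^ k\<close>
  divides \<open>Suc n\<close>, and the number of such \<open>k\<close> in \<open>{1..K}\<close> is
  the multiplicity of \<open>p\<close> in \<open>Suc n\<close>.\<close>

lemma multiplicity_fact:
  fixes p n K :: nat
  assumes p: "prime p" and "n < p ^ Suc K"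
  shows "multiplicity p (fact n :: nat) = (\<Sum>k=1..K. n div p ^ k)"
  using assms(2)
proof (induction n)
  case 0
  then show ?case by simp
next
  case (Suc n)
  have "multiplicity p (fact (Suc n) :: nat) = multiplicity p (Suc n * fact n)"
    by simp
  also have "\<dots> = multiplicity p (Suc n) + multiplicity p (fact n :: nat)"
    using p by (subst prime_elem_multiplicity_mult_distrib) auto
  also have "multiplicity p (Suc n) = (\<Sum>k=1..K. if p ^ k dvd Suc n then 1 else 0)"
    using multiplicity_eq_card[OF p _ Suc.prems] by (simp add: sum.If_cases Int_def)
  also have "multiplicity p (fact n :: nat) = (\<Sum>k=1..K. n div p ^ k)"
    using Suc by simp
  finally show ?case
    by (simp only: sum.distrib[symmetric] div_Suc_eq add.commute)
qed

lemma double_div_eq: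
  fixes n q :: nat
  assumes "q > 0"
  shows "2 * n div q = 2 * (n div q) + 2 * (n mod q) div q"
proof -
  have "2 * n = 2 * (q * (n div q) + n mod q)" by simp
  also have "\<dots> = 2 * (n mod q) + (2 * (n div q)) * q"
    by (simp only: distrib_left mult_ac add_ac)
  finally have "2 * n = 2 * (n mod q) + (2 * (n div q)) * q" .
  hence "2 * n div q = (2 * (n mod q) + (2 * (n div q)) * q) div q" by (rule arg_cong)
  also have "\<dots> = 2 * (n div q) + 2 * (n mod q) div q"
    by (rule div_mult_self1) (use assms in simp)
  finally show ?thesis .
qed

text \<open>Legendre's formula on both sides of
  \<open>fact n * fact n * (2 * n choose n) = fact (2 * n)\<close>. Truncated subtraction is
  harmless, as \<open>2 * (n div p ^ k)\<close> never exceeds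
  \<open>2 * n div p ^ k\<close>.\<close>

lemma multiplicity_central_binomial:
  fixes p n K :: nat
  assumes p: "prime p" and "2 * n < p ^ Suc K"
  shows "multiplicity p ((2 * n) choose n) = (\<Sum>k=1..K. 2 * n div p ^ k - 2 * (n div p ^ k))"
proof -
  have "fact n * fact (2 * n - n) * (2 * n choose n) = (fact (2 * n) :: nat)"
    by (rule binomial_fact_lemma) simp
  hence "fact n * fact n * (2 * n choose n) = (fact (2 * n) :: nat)"
    by (simp add: mult_2)
  hence "multiplicity p (fact (2 * n) :: nat) = multiplicity p (fact n * fact n * (2 * n choose n))"
    by simp
  also have "\<dots> = 2 * multiplicity p (fact n :: nat) + multiplicity p (2 * n choose n)"
    using p by (simp add: prime_elem_multiplicity_mult_distrib)
  finally have "multiplicity p (2 * n choose n) = (\<Sum>k=1..K. 2 * n div p ^ k) - (\<Sum>k=1..K. 2 * (n div p ^ k))"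
    using assms by (simp add: multiplicity_fact[of p _ K] sum_distrib_left)
  also have "\<dots> = (\<Sum>k=1..K. 2 * n div p ^ k - 2 * (n div p ^ k))"
  proof (rule sum_subtractf_nat[symmetric])
    show "2 * (n div p ^ k) \<le> 2 * n div p ^ k" for k
      using prime_gt_0_nat[OF p] by (subst double_div_eq) simp_all
  qed
  finally show ?thesis .
qed

text \<open>For \<open>q > 0\<close> the difference is \<open>2 * (n mod q) div q\<close>, which is
  below 2; for \<open>q > 2 * n\<close> both quotients vanish.\<close>

lemma double_div_diff_le:
  fixes n q :: nat
  shows "2 * n div q - 2 * (n div q) \<le> (if q \<le> 2 * n then 1 else 0)"
proof (cases "q = 0 \<or> q > 2 * n")
  case True
  then show ?thesis by auto
next
  case False
  then have q: "q > 0" "q \<le> 2 * n" by auto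
  have "2 * (n mod q) < 2 * q"
    using q by simp
  hence "2 * (n mod q) div q < 2"
    using q by (simp add: less_mult_imp_div_less)
  then show ?thesis using q double_div_eq[of q n] by simp
qed

text \<open>Makes the crude cutoff \<open>K = 2 * n\<close> admissible in the sum formula.\<close>

lemma less_power_Suc_nat:
  fixes p m :: nat
  assumes "p \<ge> 2"
  shows "m < p ^ Suc m"
proof -
  have "m < 2 ^ m" by (rule less_exp)
  also have "\<dots> \<le> p ^ m" using assms by (rule power_mono) simp
  also have "\<dots> \<le> p ^ Suc m" using assms by simp
  finally show ?thesis .
qed

text \<open>Each summand is at most 1 and vanishes once \<open>p ^ k > 2 * n\<close>. If the full
  prime power exceeded \<open>2 * n\<close>, only exponents below the multiplicity could contribute,
  too few to add up to it.\<close>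

lemma prime_power_multiplicity_central_binomial_le:
  fixes p n :: nat
  assumes p: "prime p" and n: "n > 0"
  shows "p ^ multiplicity p ((2 * n) choose n) \<le> 2 * n"
proof (rule ccontr)
  let ?v = "multiplicity p ((2 * n) choose n)"
  assume gt: "\<not> p ^ ?v \<le> 2 * n"
  have p2: "p \<ge> 2" using p by (rule prime_ge_2_nat)
  have "?v = (\<Sum>k=1..2*n. 2 * n div p ^ k - 2 * (n div p ^ k))"
    using p less_power_Suc_nat[OF p2] by (rule multiplicity_central_binomial)
  also have "\<dots> \<le> (\<Sum>k=1..2*n. if p ^ k \<le> 2 * n then 1 else 0)"
    by (intro sum_mono double_div_diff_le)
  also have "\<dots> = card {k \<in> {1..2*n}. p ^ k \<le> 2 * n}"
    by (simp add: sum.If_cases Int_def)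
  also have "\<dots> \<le> card {1..<?v}"
  proof (rule card_mono)
    show "{k \<in> {1..2*n}. p ^ k \<le> 2 * n} \<subseteq> {1..<?v}"
    proof safe
      fix k assume k: "k \<in> {1..2*n}" "p ^ k \<le> 2 * n"
      hence "p ^ k < p ^ ?v" using gt by simp
      hence "k < ?v" using p2 by simp
      thus "k \<in> {1..<?v}" using k by simp
    qed
  qed simp
  \<comment> \<open>The bound \<open>card {1..<?v}\<close> is \<open>?v - 1\<close>, so only
    \<open>?v = 0\<close> is left; then \<open>p ^ ?v = 1\<close> cannot exceed
    \<open>2 * n\<close>.\<close>
  finally have "?v = 0" by simp
  with gt n show False by simp
qed

text \<open>Since \<open>2 * n < 3 * p \<le> p * p\<close>, only the first power of \<open>p\<close>
  counts, and there \<open>2 * n div p = 2\<close> cancels against twice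
  \<open>n div p = 1\<close>.\<close>

lemma not_dvd_central_binomial:
  fixes p n :: nat
  assumes p: "prime p" and bounds: "p \<ge> 3" "p \<le> n" "2 * n < 3 * p"
  shows "\<not> p dvd ((2 * n) choose n)"
proof -
  have "2 * n < p * p"
    using bounds by (meson le_trans less_le_trans mult_le_mono1)
  hence "multiplicity p ((2 * n) choose n) = (\<Sum>k=1..1. 2 * n div p ^ k - 2 * (n div p ^ k))"
    using p by (intro multiplicity_central_binomial) simp_all
  moreover have "2 * n div p = 2" "n div p = 1"
    using bounds by (auto intro!: div_nat_eqI)
  ultimately have "multiplicity p ((2 * n) choose n) = 0"
    by simp
  thus ?thesis
    using p by (simp add: prime_elem_multiplicity_eq_zero_iff)
qed

section \<open>The product of the primes up to a bound\<close>

lemma prod_primes_dvd: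
  fixes m :: nat
  assumes "finite A" "\<And>p. p \<in> A \<Longrightarrow> prime p" "\<And>p. p \<in> A \<Longrightarrow> p dvd m"
  shows "\<Prod>A dvd m"
  using assms
proof (induction A)
  case (insert p A)
  have "coprime p (\<Prod>A)"
    using insert by (intro prod_coprime_right) (metis insert_iff primes_coprime)
  with insert show ?case
    by (simp add: divides_mult)
qed simp

text \<open>By symmetry the entries up to \<open>m\<close> make up half of row
  \<open>2 * m + 1\<close>, that is \<open>2 ^ (2 * m)\<close>.\<close>

lemma binomial_odd_middle_le: "(2 * m + 1) choose m \<le> 4 ^ m"
proof -
  have "(2 * m + 1) choose m \<le> (\<Sum>k\<le>m. (2 * m + 1) choose k)"
    by (rule member_le_sum) auto
  also have "\<dots> = 2 ^ (2 * m)" by (rule binomial_r_part_sum)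
  finally show ?thesis by (simp add: power_mult)
qed

text \<open>An even \<open>n > 2\<close> adds no prime to those up to \<open>n - 1\<close>. For
  \<open>n = 2 * m + 1\<close>, the primes above \<open>m + 1\<close> divide
  \<open>(2 * m + 1) choose m\<close>, which is at most \<open>4 ^ m\<close>, and the induction
  hypothesis at \<open>m + 1\<close> covers the others.\<close>

lemma prod_primes_le: "\<Prod>{p::nat. prime p \<and> p \<le> n} \<le> 4 ^ n"
proof (induction n rule: less_induct)
  case (less n)
  consider "n \<le> 1" | "n = 2" | "n > 2" "even n" | m where "n = 2 * m + 1" "m > 0"
  proof -
    have "n \<le> 1 \<or> n = 2 \<or> n > 2 \<and> even n \<or> (\<exists>m. n = 2 * m + 1 \<and> m > 0)"
      by presburger
    thus thesis using that by blast
  qed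
  then show ?case
  proof cases
    case 1
    hence "{p::nat. prime p \<and> p \<le> n} = {}"
      by (auto dest: prime_gt_1_nat)
    thus ?thesis by (metis prod.empty one_le_power one_le_numeral)
  next
    case 2
    hence "{p::nat. prime p \<and> p \<le> n} = {2}"
      by (auto dest: prime_ge_2_nat)
    thus ?thesis using 2 by simp
  next
    case 3
    hence "\<not> prime n" using prime_odd_nat by blast
    hence "{p::nat. prime p \<and> p \<le> n} = {p. prime p \<and> p \<le> n - 1}"
      by (auto simp: le_less intro: Suc_leI)
    hence "\<Prod>{p::nat. prime p \<and> p \<le> n} \<le> 4 ^ (n - 1)"
      using less.IH[of "n - 1"] 3 by simp
    also have "\<dots> \<le> 4 ^ n" by (intro power_increasing) auto
    finally show ?thesis .
  next
    case 4
    let ?A = "{p::nat. prime p \<and> p \<le> m + 1}"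
    let ?B = "{p::nat. prime p \<and> m + 1 < p \<and> p \<le> n}"
    have split: "{p::nat. prime p \<and> p \<le> n} = ?A \<union> ?B" "?A \<inter> ?B = {}"
      using 4 by auto
    have fin: "finite ?A" "finite ?B"
      by (auto intro: finite_subset[of _ "{..n}"] finite_subset[of _ "{..m+1}"])
    have "\<Prod>?B dvd ((2 * m + 1) choose m)"
    proof (rule prod_primes_dvd)
      fix p assume p: "p \<in> ?B"
      have "fact m * fact (2 * m + 1 - m) * ((2 * m + 1) choose m) = (fact (2 * m + 1) :: nat)"
        by (rule binomial_fact_lemma) simp
      moreover have "p dvd (fact (2 * m + 1) :: nat)" 
        using p 4 by (subst prime_dvd_fact_iff) auto
      ultimately have "p dvd fact m * fact (2 * m + 1 - m) * ((2 * m + 1) choose m)"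
        by simp
      moreover have "\<not> p dvd (fact m :: nat)" "\<not> p dvd (fact (2 * m + 1 - m) :: nat)"
        using p by (auto simp: prime_dvd_fact_iff simp del: fact_Suc)
      ultimately show "p dvd ((2 * m + 1) choose m)"
        using p by (simp add: prime_dvd_mult_iff)
    qed (use fin in auto)
    hence "\<Prod>?B \<le> (2 * m + 1) choose m"
      by (rule dvd_imp_le) simp
    also have "\<dots> \<le> 4 ^ m" by (rule binomial_odd_middle_le)
    finally have B: "\<Prod>?B \<le> 4 ^ m" .
    have A: "\<Prod>?A \<le> 4 ^ (m + 1)"
      using 4 by (intro less.IH) auto
    have "\<Prod>{p::nat. prime p \<and> p \<le> n} = \<Prod>?A * \<Prod>?B"
      unfolding split(1) using fin split(2) by (rule prod.union_disjoint)
    also have "\<dots> \<le> 4 ^ (m + 1) * 4 ^ m"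
      using A B by (rule mult_le_mono)
    also have "\<dots> = 4 ^ n"
      using 4 by (simp add: mult_2 power_add)
    finally show ?thesis .
  qed
qed

section \<open>Bertrand's postulate\<close>

text \<open>The right side doubles at each step, while the left side grows by a factor of at most
  \<open>(11 / 10) ^ 6 < 2\<close>. The base case is \<open>31 ^ 6 \<le> 2 ^ 30\<close>; at
  \<open>s = 29\<close> the inequality still fails.\<close>

lemma Suc_power6_le_exp2:
  fixes s :: nat
  assumes "s \<ge> 30"
  shows "(s + 1) ^ 6 \<le> 2 ^ s"
  using assms
proof (induction s rule: dec_induct)
  case (step s)
  have "10 ^ 6 * (s + 2) ^ 6 = (10 * (s + 2)) ^ 6"
    by (rule power_mult_distrib[symmetric])
  also have "\<dots> \<le> (11 * (s + 1)) ^ 6"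
    using step by (intro power_mono) auto
  also have "\<dots> = 11 ^ 6 * (s + 1) ^ 6"
    by (rule power_mult_distrib)
  also have "\<dots> \<le> 10 ^ 6 * (2 * 2 ^ s)"
    using step.IH by simp
  finally show ?case by simp
qed simp

text \<open>Here \<open>s\<close> stands for the rounded square root of \<open>2 * n\<close>. The at
  most \<open>s - 1\<close> primes up to \<open>s\<close> contribute at most \<open>2 * n\<close>
  each; larger ones have exponent one and together contribute at most the product of all primes up
  to \<open>2 * n div 3\<close>.\<close>

lemma central_binomial_le_if_no_prime:
  fixes n s :: nat
  assumes n: "n \<ge> 3" and no: "\<not> (\<exists>p. prime p \<and> n < p \<and> p \<le> 2 * n)"
    and s: "s > 0" "2 * n < (s + 1)\<^sup>2"
  shows "((2 * n) choose n) \<le> (2 * n) ^ (s - 1) * 4 ^ (2 * n div 3)"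
proof -
  let ?C = "(2 * n) choose n"
  let ?v = "\<lambda>p. multiplicity p ?C"
  let ?A = "{p \<in> prime_factors ?C. p \<le> s}"
  let ?B = "{p \<in> prime_factors ?C. s < p}"
  have le: "p ^ ?v p \<le> 2 * n" if "p \<in> prime_factors ?C" for p
    using that n by (intro prime_power_multiplicity_central_binomial_le) auto
  \<comment> \<open>A prime factor is at most its own prime power, hence at most
    \<open>2 * n\<close>. The assumption \<open>no\<close> brings it down to \<open>n\<close>, and
    \<open>not_dvd_central_binomial\<close> excludes the rest of the range.\<close>
  have small: "p \<le> 2 * n div 3" if p: "p \<in> prime_factors ?C" for p
  proof (rule ccontr)
    assume "\<not> p \<le> 2 * n div 3"
    hence p3: "2 * n < 3 * p" by auto
    have "prime p" "p dvd ?C" using p by auto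
    have "?v p > 0" using p by (simp add: prime_factors_multiplicity)
    hence "p ^ 1 \<le> p ^ ?v p"
      using \<open>prime p\<close> by (intro power_increasing) (auto dest: prime_gt_0_nat)
    hence "p \<le> 2 * n" using le[OF p] by simp
    hence "p \<le> n" using no \<open>prime p\<close> by (metis not_less)
    moreover have "p \<ge> 3" using p3 n by linarith
    ultimately show False
      using not_dvd_central_binomial \<open>prime p\<close> \<open>p dvd ?C\<close> p3 by blast
  qed
  have "?C = (\<Prod>p\<in>prime_factors ?C. p ^ ?v p)"
    by (rule prime_factorization_nat) simp
  also have "prime_factors ?C = ?A \<union> ?B" by auto
  also have "(\<Prod>p\<in>?A \<union> ?B. p ^ ?v p) = (\<Prod>p\<in>?A. p ^ ?v p) * (\<Prod>p\<in>?B. p ^ ?v p)"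
    by (rule prod.union_disjoint) auto
  also have "\<dots> \<le> (2 * n) ^ (s - 1) * 4 ^ (2 * n div 3)"
  proof (rule mult_le_mono)
    have "(\<Prod>p\<in>?A. p ^ ?v p) \<le> (\<Prod>p\<in>?A. 2 * n)"
      using le by (intro prod_mono) auto
    also have "\<dots> = (2 * n) ^ card ?A" by simp
    also have "\<dots> \<le> (2 * n) ^ (s - 1)"
    proof (rule power_increasing)
      have "card ?A \<le> card {2..s}"
        by (intro card_mono) (auto intro!: prime_ge_2_nat)
      thus "card ?A \<le> s - 1" by simp
    qed (use n in auto)
    finally show "(\<Prod>p\<in>?A. p ^ ?v p) \<le> (2 * n) ^ (s - 1)" .
  next
    have "p ^ ?v p \<le> p" if p: "p \<in> ?B" for p
    proof -
      have "p ^ ?v p \<le> 2 * n" using p le by blast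
      also note s(2)
      also have "(s + 1)\<^sup>2 \<le> p\<^sup>2" using p by (intro power_mono) auto
      finally have "p ^ ?v p < p\<^sup>2" .
      hence "?v p < 2"
        by (rule power_less_imp_less_exp[rotated]) (use p in \<open>auto intro!: prime_gt_1_nat[unfolded One_nat_def]\<close>)
      hence "p ^ ?v p \<le> p ^ 1"
        using p by (intro power_increasing) (auto dest: prime_gt_0_nat)
      thus ?thesis by simp
    qed
    hence "(\<Prod>p\<in>?B. p ^ ?v p) \<le> \<Prod>?B"
      by (intro prod_mono) auto
    also have "\<dots> \<le> \<Prod>{p::nat. prime p \<and> p \<le> 2 * n div 3}"
    proof (rule dvd_imp_le)
      show "\<Prod>?B dvd \<Prod>{p::nat. prime p \<and> p \<le> 2 * n div 3}"
      proof (rule prod_dvd_prod_subset)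
        show "finite {p::nat. prime p \<and> p \<le> 2 * n div 3}"
          by (rule finite_subset[of _ "{..2 * n div 3}"]) auto
      qed (use small in auto)
      show "\<Prod>{p::nat. prime p \<and> p \<le> 2 * n div 3} > 0"
        by (rule prod_pos) (auto dest: prime_gt_0_nat)
    qed
    also have "\<dots> \<le> 4 ^ (2 * n div 3)" by (rule prod_primes_le)
    finally show "(\<Prod>p\<in>?B. p ^ ?v p) \<le> 4 ^ (2 * n div 3)" .
  qed
  finally show ?thesis .
qed

text \<open>Comparing both bounds on the central binomial coefficient leaves
  \<open>4 ^ d \<le> (2 * n) ^ s\<close>, with \<open>d\<close> about \<open>n / 3\<close> and
  \<open>s\<close> about the square root of \<open>2 * n\<close>; the left side grows
  faster.\<close>

lemma bertrand_large:
  fixes n :: nat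
  assumes n: "n \<ge> 450"
  shows "\<exists>p. prime p \<and> n < p \<and> p \<le> 2 * n"
proof (rule ccontr)
  assume no: "\<not> ?thesis"
  define s where "s = floor_sqrt (2 * n)"
  define d where "d = n - 2 * n div 3"
  \<comment> \<open>The threshold 450 is half of \<open>30 * 30\<close>, and 30 is the bound in
    \<open>Suc_power6_le_exp2\<close>.\<close>
  have "floor_sqrt (30\<^sup>2) \<le> floor_sqrt (2 * n)"
    by (rule mono_floor_sqrt') (use n in simp)
  hence s30: "s \<ge> 30" by (simp only: s_def floor_sqrt_inverse_power2)
  have s_le: "s\<^sup>2 \<le> 2 * n" by (simp add: s_def)
  have s_gt: "2 * n < (s + 1)\<^sup>2"
    using Suc_floor_sqrt_power2_gt[of "2 * n"] by (simp add: s_def)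
  have d: "n = 2 * n div 3 + d" "n \<le> 3 * d"
    by (auto simp: d_def)
  have "real (4 ^ n) \<le> real (2 * n * ((2 * n) choose n))"
    using central_binomial_lower_bound[of n] n by (simp add: field_simps)
  hence "4 ^ n \<le> 2 * n * ((2 * n) choose n)"
    by (simp only: of_nat_le_iff)
  also have "\<dots> \<le> 2 * n * ((2 * n) ^ (s - 1) * 4 ^ (2 * n div 3))"
    using central_binomial_le_if_no_prime[OF _ no _ s_gt] n s30
    by (intro mult_le_mono) auto
  \<comment> \<open>The factor \<open>2 * n\<close> from the lower bound raises the exponent
    \<open>s - 1\<close> to \<open>s\<close>.\<close>
  also have "\<dots> = (2 * n) ^ s * 4 ^ (2 * n div 3)"
    using s30 by (simp add: power_eq_if)
  finally have "4 ^ (2 * n div 3) * 4 ^ d \<le> 4 ^ (2 * n div 3) * (2 * n) ^ s"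
    by (subst (asm) d(1)) (simp only: power_add mult.commute)
  hence "4 ^ d \<le> (2 * n) ^ s"
    by simp
  \<comment> \<open>Cubing clears the third in \<open>n \<le> 3 * d\<close>, so that the chain
    returns to its own left side.\<close>
  hence "(4 ^ d) ^ 3 \<le> ((2 * n) ^ s) ^ 3"
    by (rule power_mono) simp
  also have "\<dots> < (((s + 1)\<^sup>2) ^ s) ^ 3"
    using s_gt s30 by (intro power_strict_mono) auto
  also have "\<dots> = ((s + 1) ^ 6) ^ s"
    by (simp flip: power_mult add: mult.commute)
  also have "\<dots> \<le> (2 ^ s) ^ s"
    using Suc_power6_le_exp2[OF s30] by (rule power_mono) simp
  also have "\<dots> = 2 ^ s\<^sup>2"
    by (simp add: power_mult power2_eq_square)
  also have "\<dots> \<le> 2 ^ (2 * (3 * d))"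
    using s_le d(2) by (intro power_increasing) auto
  also have "\<dots> = (4 ^ d) ^ 3"
    by (subst power_mult) (simp add: mult.commute flip: power_mult)
  finally show False by simp
qed

theorem bertrand:
  fixes n :: nat
  assumes "n \<ge> 1"
  shows "\<exists>p. prime p \<and> n < p \<and> p \<le> 2 * n"
proof (cases "n \<ge> 450")
  case True
  then show ?thesis by (rule bertrand_large)
next
  case False
  \<comment> \<open>One prime \<open>p\<close> serves every \<open>n\<close> from \<open>l\<close>
    to \<open>p - 1\<close>; below, \<open>l\<close> is 1 or the preceding prime of the
    list.\<close>
  have step: ?thesis if "prime p" "n < p" "l \<le> n" "p \<le> 2 * l" for p l
    using that by (intro exI[of _ p]) auto
  have primes: "prime (2::nat)" "prime (3::nat)" "prime (5::nat)" "prime (7::nat)" "prime (13::nat)"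
    "prime (23::nat)" "prime (43::nat)" "prime (83::nat)" "prime (163::nat)" "prime (317::nat)"
    "prime (631::nat)"
    by simp_all
  txt \<open>Each prime in this chain is less than twice its predecessor.\<close>
  consider "1 \<le> n" "n < 2" | "2 \<le> n" "n < 3" | "3 \<le> n" "n < 5" | "5 \<le> n" "n < 7" | "7 \<le> n" "n < 13"
    | "13 \<le> n" "n < 23" | "23 \<le> n" "n < 43" | "43 \<le> n" "n < 83" | "83 \<le> n" "n < 163"
    | "163 \<le> n" "n < 317" | "317 \<le> n" "n < 631"
    using assms False by linarith
  then show ?thesis
    by cases (rule step, rule primes, assumption, assumption, simp)+
qed

section \<open>The intervals of the recursion\<close>

text \<open>The value 1 at index 0 makes \<open>IpP 1 = {2}\<close> the half-open interval \<open>{1<..2}\<close>, like all later ones.\<close>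

definition endpoint :: "nat \<Rightarrow> nat" where
  "endpoint i = (if i = 0 then 1 else Max (IpP i))"

text \<open>The conjuncts feed each other in one induction: membership of the \<open>Max\<close>
  carries nonemptiness, the bound by twice the \<open>Max\<close> makes the next interval nonempty,
  and maximality among all primes up to the endpoint pushes Bertrand's prime beyond it.\<close>

lemma IpP_pP_structure:
  "IpP (Suc i) = {endpoint i<..endpoint (Suc i)} \<and>
   pP (Suc i) = primes_in (IpP (Suc i)) \<and>
   endpoint i < endpoint (Suc i) \<and>
   Max (pP (Suc i)) \<in> pP (Suc i) \<and> endpoint (Suc i) < 2 * Max (pP (Suc i)) \<and>
   (\<forall>p. prime p \<longrightarrow> p \<le> endpoint (Suc i) \<longrightarrow> p \<le> Max (pP (Suc i)))"
proof (induction i)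
  case 0
  have "{Suc 0<..2} = {2}" by auto
  then show ?case by (auto simp: endpoint_def primes_in_def)
next
  case (Suc i)
  define q where "q = Max (pP (Suc i))"
  define m where "m = endpoint (Suc i)"
  have q: "prime q" "q \<le> m" "m < 2 * q" "\<And>p. prime p \<Longrightarrow> p \<le> m \<Longrightarrow> p \<le> q"
    using Suc.IH unfolding q_def m_def by (auto simp: primes_in_def)
  have I: "IpP (Suc (Suc i)) = {m<..2 * q}"
    by (auto simp: m_def endpoint_def q_def)
  \<comment> \<open>The interval is nonempty by \<open>m < 2 * q\<close>, so its maximum is its
    right end.\<close>
  have e: "endpoint (Suc (Suc i)) = 2 * q"
    using q(3) unfolding endpoint_def I by (simp add: Max_eq_iff)
  have P: "pP (Suc (Suc i)) = primes_in {m<..2 * q}"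
    using I by (simp only: pP.simps)
  obtain p where p: "prime p" "q < p" "p \<le> 2 * q"
    using bertrand[of q] q(1) prime_ge_1_nat by blast
  define r where "r = Max (pP (Suc (Suc i)))"
  \<comment> \<open>If \<open>p \<le> m\<close>, maximality of \<open>q\<close> would give
    \<open>p \<le> q\<close>.\<close>
  have "p \<in> pP (Suc (Suc i))"
    using p q(4)[of p] unfolding P primes_in_def by force
  moreover have fin: "finite (pP (Suc (Suc i)))"
    unfolding P primes_in_def by simp
  ultimately have M: "r \<in> pP (Suc (Suc i))"
    unfolding r_def by (intro Max_in) auto
  have r: "prime r" "m < r" "r \<le> 2 * q"
    using M unfolding P primes_in_def by auto
  have "p \<le> r" if "prime p" "p \<le> 2 * q" for p
  proof (cases "p \<le> m")
    case True
    then show ?thesis using r by simp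
  next
    case False
    then show ?thesis using that fin unfolding r_def P primes_in_def by (intro Max_ge) auto
  qed
  \<comment> \<open>The new endpoint \<open>2 * q\<close> is below \<open>2 * r\<close> because
    \<open>q \<le> m < r\<close>.\<close>
  with M r q(2,3) show ?case
    unfolding r_def[symmetric] unfolding e I P m_def[symmetric] by auto
qed

section \<open>The partition of the primes\<close>

text \<open>The piece containing \<open>x\<close> ends at \<open>f j\<close> for the least
  \<open>j\<close> with \<open>x \<le> f j\<close>; such a \<open>j\<close> exists because
  \<open>x \<le> f x\<close>, and it is not 0 because \<open>x > f 0\<close>.\<close>

lemma UN_greaterThanAtMost_Suc:
  fixes f :: "nat \<Rightarrow> nat"
  assumes "strict_mono f"
  shows "(\<Union>i. {f i<..f (Suc i)}) = {f 0<..}"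
proof safe
  fix i x assume "x \<in> {f i<..f (Suc i)}"
  moreover have "f 0 \<le> f i"
    using assms by (simp add: strict_mono_less_eq)
  ultimately show "x > f 0" by simp
next
  fix x assume x: "x > f 0"
  define j where "j = (LEAST j. x \<le> f j)"
  have "x \<le> f x" using assms by (rule strict_mono_imp_increasing)
  hence j: "x \<le> f j" unfolding j_def by (rule LeastI)
  with x obtain i where i: "j = Suc i" by (cases j) auto
  have "\<not> x \<le> f i"
    using i not_less_Least[of i "\<lambda>j. x \<le> f j"] by (simp add: j_def)
  thus "x \<in> (\<Union>i. {f i<..f (Suc i)})"
    using i j by (auto simp: not_le)
qed

text \<open>As \<open>partition_on\<close> sees only the set of values, where equal parts would
  merge, \<open>disjoint_family_on\<close> adds disjointness for different indices.\<close>

theorem theorem3p4: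
  shows "({p::nat. prime p} = primes_in {1..} \<and> primes_in {1..} = (\<Union>j\<in>{1..}. pP j))
         \<and> (partition_on {p::nat. prime p} (pP ` {1..}) \<and> disjoint_family_on pP {1..})"
proof -
  have mono: "strict_mono endpoint"
    using IpP_pP_structure by (auto simp: strict_mono_Suc_iff)
  have pP: "pP (Suc i) = {p. prime p \<and> p \<in> {endpoint i<..endpoint (Suc i)}}" for i
    using IpP_pP_structure[of i] by (auto simp: primes_in_def)
  have pos: "{1..} = range Suc"
    by (auto simp: Suc_le_eq gr0_conv_Suc)
  have all: "{p::nat. prime p} = primes_in {1..}"
    by (auto simp: primes_in_def dest: prime_gt_0_nat)
  have "(\<Union>j\<in>{1..}. pP j) = {p. prime p \<and> p \<in> (\<Union>i. {endpoint i<..endpoint (Suc i)})}"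
    unfolding pos by (auto simp: pP)
  \<comment> \<open>Since \<open>endpoint 0 = 1\<close>, the intervals cover all numbers above 1,
    hence all primes.\<close>
  also have "\<dots> = {p. prime p}"
    unfolding UN_greaterThanAtMost_Suc[OF mono]
    by (auto simp: endpoint_def dest: prime_gt_1_nat)
  finally have union: "(\<Union>j\<in>{1..}. pP j) = {p. prime p}" .
  have ne: "pP j \<noteq> {}" if "j \<in> {1..}" for j
    using that IpP_pP_structure unfolding pos by blast
  have disj: "disjoint_family_on pP {1..}"
    unfolding pos
    unfolding disjoint_family_on_def
  proof (intro ballI impI)
    fix m n assume "m \<in> range Suc" "n \<in> range Suc" "m \<noteq> n"
    then obtain i j where ij: "m = Suc i" "n = Suc j" "i \<noteq> j" by auto
    have "{endpoint i<..endpoint (Suc i)} \<inter> {endpoint j<..endpoint (Suc j)} = {}"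
    proof (cases "i < j")
      case True
      hence "endpoint (Suc i) \<le> endpoint j" using mono by (simp add: strict_mono_less_eq)
      thus ?thesis by auto
    next
      case False
      hence "endpoint (Suc j) \<le> endpoint i" using mono ij by (simp add: strict_mono_less_eq)
      thus ?thesis by auto
    qed
    thus "pP m \<inter> pP n = {}" unfolding ij pP by blast
  qed
  have "partition_on {p::nat. prime p} (pP ` {1..})"
  proof (rule partition_onI)
    show "\<Union> (pP ` {1..}) = {p. prime p}" by (rule union)
    show "disjnt X Y" if "X \<in> pP ` {1..}" "Y \<in> pP ` {1..}" "X \<noteq> Y" for X Y
    proof -
      obtain i j where "i \<in> {1..}" "j \<in> {1..}" "X = pP i" "Y = pP j"
        using \<open>X \<in> _\<close> \<open>Y \<in> _\<close> by blast
      with \<open>X \<noteq> Y\<close> disj show ?thesis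
        unfolding disjoint_family_on_def disjnt_def by metis
    qed
    show "{} \<notin> pP ` {1..}"
      using ne by (metis imageE)
  qed
  moreover have "primes_in {1..} = (\<Union>j\<in>{1..}. pP j)"
    unfolding union all ..
  ultimately show ?thesis
    using all disj by blast
qed

end
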